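(* Let $\lambda\in\mathbb{R}$, let $\alpha>0$, and let $X_\lambda$ be a degenerate zero-truncated Poisson random variable with parameter $\alpha$. Then $$E[X_\lambda^n]=\frac{1}{1-e_\lambda^{-1}(\alpha)}\,\beta_{n,\lambda}(\alpha)\qquad(n\in\mathbb{N}=\{1,2,3,\dots\}),$$ where $\beta_{n,\lambda}$ are the degenerate Bell polynomials. In particular, for $n=0$, $E[1]=E[X_\lambda^0]=1$.
   Context: For real $x,\lambda$ the $\lambda$-falling factorials are $(x)_{0,\lambda}=1$ and $(x)_{n,\lambda}=x(x-\lambda)(x-2\lambda)\cdots(x-(n-1)\lambda)$ for $n\ge1$. The degenerate exponential is $e_\lambda^x(t)=(1+\lambda t)^{x/\lambda}=\sum_{n=0}^\infty (x)_{n,\lambda}\frac{t^n}{n!}$ (for $\lambda=0$ it is understood as the limit $e^{xt}$), with $e_\lambda(t)=e_\lambda^1(t)$ and $e_\lambda^{-1}(t)=1/e_\lambda(t)$. The degenerate Bell polynomials $\beta_{n,\lambda}(x)$, $n\ge0$, are defined by the generating function (power series expansion in $t$ around $0$) $$e_\lambda^{-1}(x)\,e_\lambda(xe^t)=\sum_{n=0}^\infty\beta_{n,\lambda}(x)\frac{t^n}{n!}.$$ A random variable $X_\lambda$ taking values in $\{1,2,3,\dots\}$ is a degenerate zero-truncated Poisson random variable with parameter $\alpha>0$ if its probability mass function is $$P_\lambda(n)=P\{X_\lambda=n\}=\frac{1}{e_\lambda(\alpha)-1}\,\frac{\alpha^n}{n!}\,(1)_{n,\lambda},\qquad n=1,2,3,\dots$$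 As part of this definition, $\lambda$ and $\alpha$ are such that this formula is meaningful and is a probability mass function (the values are nonnegative, and the series $\sum_{n\ge 0}(1)_{n,\lambda}\alpha^n/n!$ converges to $e_\lambda(\alpha)$, so that the values sum to $1$). *)

theory Defs
  imports "HOL-Probability.Probability"
begin

definition lambda_falling :: "real \<Rightarrow> real \<Rightarrow> nat \<Rightarrow> real" where
  "lambda_falling lam x n = (\<Prod>k<n. x - real k * lam)"

text \<open>The power is a genuine real power only where \<open>1 + lam * t > 0\<close> (or \<open>lam = 0\<close>).\<close>

definition degenerate_exp :: "real \<Rightarrow> real \<Rightarrow> real \<Rightarrow> real" where
  "degenerate_exp lam x t =
     (if lam = 0 then exp (x * t) else (1 + lam * t) powr (x / lam))"

definition degenerate_exp_inv :: "real \<Rightarrow> real \<Rightarrow> real" where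
  "degenerate_exp_inv lam t = 1 / degenerate_exp lam 1 t"

text \<open>
  \<open>Abs_fps (\<lambda>n. b n / fact n)\<close> is the exponential generating series of \<open>b\<close>.  The series
  exists, and determines the sequence uniquely, whenever \<open>1 + lam * x > 0\<close>.
\<close>

definition degenerate_Bell :: "real \<Rightarrow> nat \<Rightarrow> real \<Rightarrow> real" where
  "degenerate_Bell lam n x =
     (THE b :: nat \<Rightarrow> real.
        (\<lambda>t. degenerate_exp_inv lam x * degenerate_exp lam 1 (x * exp t))
          has_fps_expansion Abs_fps (\<lambda>n. b n / fact n)) n"

definition degenerate_ztp_mass :: "real \<Rightarrow> real \<Rightarrow> nat \<Rightarrow> real" where
  "degenerate_ztp_mass lam \<alpha> n =
     1 / (degenerate_exp lam 1 \<alpha> - 1) * (\<alpha> ^ n / fact n) * lambda_falling lam 1 n"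

text \<open>
  The parameters for which the mass formula is a probability mass function on the positive
  integers.  The condition \<open>1 + lam * \<alpha> > 0\<close> makes the real power \<open>degenerate_exp lam 1 \<alpha>\<close>
  meaningful; it excludes nothing, being automatic for \<open>lam \<ge> 0\<close> and, for \<open>lam < 0\<close>,
  necessary for the series to converge.
\<close>

definition degenerate_ztp_params :: "real \<Rightarrow> real \<Rightarrow> bool" where
  "degenerate_ztp_params lam \<alpha> \<longleftrightarrow>
     \<alpha> > 0 \<and> 1 + lam * \<alpha> > 0 \<and>
     (\<forall>n\<ge>1. degenerate_ztp_mass lam \<alpha> n \<ge> 0) \<and>
     (\<lambda>n. lambda_falling lam 1 n * \<alpha> ^ n / fact n) sums degenerate_exp lam 1 \<alpha>"

definition degenerate_ztp_rv :: "'a measure \<Rightarrow> real \<Rightarrow> real \<Rightarrow> ('a \<Rightarrow> nat) \<Rightarrow> bool" where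
  "degenerate_ztp_rv M lam \<alpha> X \<longleftrightarrow>
     degenerate_ztp_params lam \<alpha> \<and>
     X \<in> measurable M (count_space UNIV) \<and>
     (\<forall>\<omega>\<in>space M. X \<omega> \<ge> 1) \<and>
     (\<forall>n\<ge>1. measure M {\<omega> \<in> space M. X \<omega> = n} = degenerate_ztp_mass lam \<alpha> n)"

end

theory Submission
  imports Defs
begin

text \<open>
  Write \<open>e\<close> for \<open>degenerate_exp lam 1\<close>.  The masses are the terms of the series
  \<open>e(\<alpha>) = \<Sum>n. (1)\<^bsub>n,lam\<^esub> \<alpha>^n / n!\<close> with the term of index \<open>0\<close> removed, normalised by
  \<open>e(\<alpha>) - 1\<close>.  Replacing \<open>\<alpha>\<close> by \<open>\<alpha> exp t\<close> multiplies the term of index \<open>n\<close> by \<open>exp (t n)\<close>, so the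
  moment generating function of \<open>X\<close> is \<open>(e(\<alpha> exp t) - 1) / (e(\<alpha>) - 1)\<close>
  (\<open>degenerate_ztp_exponential_moment\<close>).  Up to an affine change, which is visible in the
  coefficients only through the factor \<open>1 - 1 / e(\<alpha>)\<close> and the constant term, this is the function
  \<open>e(\<alpha> exp t) / e(\<alpha>)\<close> whose Taylor coefficients define the degenerate Bell polynomials, while the
  Taylor coefficients of a moment generating function are the moments
  (\<open>moment_generating_function_sums\<close>).  Comparing coefficients gives the formula.

  The analytic point is that the moment generating function must be finite for some positive \<open>t\<close>,
  that is, the series of \<open>e\<close> must represent \<open>e\<close> somewhat beyond \<open>\<alpha>\<close>, although only its value
  at \<open>\<alpha>\<close> is given (\<open>degenerate_exp_sums_beyond\<close>).  Nonnegativity of the masses helps here: it leaves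
  only \<open>lam \<le> 0\<close>, where \<open>\<alpha>\<close> lies strictly inside the interval of convergence, and
  \<open>lam = 1 / m\<close> with a positive integer \<open>m\<close>, where the series is a polynomial.
\<close>

section \<open>Moments from an exponential moment\<close>

lemma exp_real_sums:
  fixes x :: real
  shows "(\<lambda>k. x ^ k / fact k) sums exp x"
  using exp_converges[of x] by (simp add: scaleR_conv_of_real field_simps)

lemma exp_partial_sum_bound:
  fixes x :: real
  assumes "x \<ge> 0"
  shows "(\<Sum>k<n. x ^ k / fact k) \<le> exp x"
  using sum_le_suminf[of "\<lambda>k. x ^ k / fact k" "{..<n}"] exp_real_sums[of x] assms
  by (simp add: sums_iff)

lemma power_le_fact_mult_exp:
  fixes x :: real
  assumes "x \<ge> 0"
  shows "x ^ k \<le> fact k * exp x"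
proof -
  have "(\<Sum>i\<in>{k}. x ^ i / fact i) \<le> (\<Sum>i<Suc k. x ^ i / fact i)"
    using assms by (intro sum_mono2) auto
  also have "\<dots> \<le> exp x"
    using assms by (rule exp_partial_sum_bound)
  finally show ?thesis
    by (simp add: field_simps)
qed

text \<open>
  A nonnegative variable with one positive exponential moment has all moments, since
  a power is dominated by a multiple of the exponential.
\<close>

lemma integrable_power_of_exponential_moment:
  fixes Y :: "'a \<Rightarrow> real"
  assumes [measurable]: "Y \<in> borel_measurable M"
    and nonneg: "\<And>\<omega>. \<omega> \<in> space M \<Longrightarrow> Y \<omega> \<ge> 0"
    and s: "s > 0"
    and int: "integrable M (\<lambda>\<omega>. exp (s * Y \<omega>))"
  shows "integrable M (\<lambda>\<omega>. Y \<omega> ^ k)"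
proof (rule Bochner_Integration.integrable_bound)
  show "integrable M (\<lambda>\<omega>. fact k / s ^ k * exp (s * Y \<omega>))"
    using int by (intro integrable_mult_right)
  show "AE \<omega> in M. norm (Y \<omega> ^ k) \<le> norm (fact k / s ^ k * exp (s * Y \<omega>))"
  proof (intro AE_I2)
    fix \<omega> assume "\<omega> \<in> space M"
    then have "s * Y \<omega> \<ge> 0" using nonneg s by simp
    then have "(s * Y \<omega>) ^ k \<le> fact k * exp (s * Y \<omega>)"
      by (rule power_le_fact_mult_exp)
    then show "norm (Y \<omega> ^ k) \<le> norm (fact k / s ^ k * exp (s * Y \<omega>))"
      using nonneg[OF \<open>\<omega> \<in> space M\<close>] s
      by (simp add: field_simps power_mult_distrib)
  qed
qed measurable

text \<open>
  Integrating the exponential series of \<open>t * Y\<close> term by term is justified by dominated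
  convergence: the single function \<open>exp (s * Y)\<close> bounds all partial sums when \<open>\<bar>t\<bar> \<le> s\<close>.
\<close>

lemma moment_generating_function_sums:
  fixes Y :: "'a \<Rightarrow> real"
  assumes [measurable]: "Y \<in> borel_measurable M"
    and nonneg: "\<And>\<omega>. \<omega> \<in> space M \<Longrightarrow> Y \<omega> \<ge> 0"
    and s: "s > 0"
    and int: "integrable M (\<lambda>\<omega>. exp (s * Y \<omega>))"
    and t: "\<bar>t\<bar> \<le> s"
  shows "(\<lambda>k. (\<integral>\<omega>. Y \<omega> ^ k \<partial>M) / fact k * t ^ k) sums (\<integral>\<omega>. exp (t * Y \<omega>) \<partial>M)"
proof -
  have "(\<lambda>n. \<integral>\<omega>. (\<Sum>k<n. (t * Y \<omega>) ^ k / fact k) \<partial>M) \<longlonglongrightarrow> (\<integral>\<omega>. exp (t * Y \<omega>) \<partial>M)"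
  proof (rule integral_dominated_convergence[where w = "\<lambda>\<omega>. exp (s * Y \<omega>)"])
    show "AE \<omega> in M. (\<lambda>n. \<Sum>k<n. (t * Y \<omega>) ^ k / fact k) \<longlonglongrightarrow> exp (t * Y \<omega>)"
      using exp_real_sums by (simp add: sums_def)
    fix n
    show "AE \<omega> in M. norm (\<Sum>k<n. (t * Y \<omega>) ^ k / fact k) \<le> exp (s * Y \<omega>)"
    proof (intro AE_I2)
      fix \<omega> assume \<omega>: "\<omega> \<in> space M"
      have "norm (\<Sum>k<n. (t * Y \<omega>) ^ k / fact k) \<le> (\<Sum>k<n. norm ((t * Y \<omega>) ^ k / fact k))"
        by (rule norm_sum)
      also have "\<dots> \<le> (\<Sum>k<n. (s * Y \<omega>) ^ k / fact k)"
        using nonneg[OF \<omega>] t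
        by (intro sum_mono) (auto simp: abs_mult power_abs intro!: divide_right_mono power_mono mult_right_mono)
      also have "\<dots> \<le> exp (s * Y \<omega>)"
        using nonneg[OF \<omega>] s by (intro exp_partial_sum_bound) simp
      finally show "norm (\<Sum>k<n. (t * Y \<omega>) ^ k / fact k) \<le> exp (s * Y \<omega>)" .
    qed
  qed (use int in measurable)
  moreover have "(\<integral>\<omega>. (\<Sum>k<n. (t * Y \<omega>) ^ k / fact k) \<partial>M)
      = (\<Sum>k<n. (\<integral>\<omega>. Y \<omega> ^ k \<partial>M) / fact k * t ^ k)" for n
  proof -
    have "integrable M (\<lambda>\<omega>. Y \<omega> ^ k)" for k
      using assms(1-4) by (rule integrable_power_of_exponential_moment)
    then show ?thesis
      by (simp add: power_mult_distrib mult_ac)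
  qed
  ultimately show ?thesis
    by (simp add: sums_def)
qed

section \<open>Expectations of functions of a discrete random variable\<close>

lemma (in prob_space) expectation_of_nat_valued:
  fixes X :: "'a \<Rightarrow> nat" and g p :: "nat \<Rightarrow> real"
  assumes X: "X \<in> measurable M (count_space UNIV)"
    and p: "\<And>n. prob {\<omega> \<in> space M. X \<omega> = n} = p n"
    and sums: "(\<lambda>n. p n * g n) sums S"
    and nonneg: "\<And>n. g n \<ge> 0"
  shows "integrable M (\<lambda>\<omega>. g (X \<omega>))" "expectation (\<lambda>\<omega>. g (X \<omega>)) = S"
proof -
  have p_nonneg: "p n \<ge> 0" for n
    using p[of n] by (metis measure_nonneg)
  have distr: "distributed M (count_space UNIV) X p"
    unfolding distributed_def
  proof (intro conjI)
    show "distr M (count_space UNIV) X = density (count_space UNIV) (\<lambda>n. ennreal (p n))"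
    proof (rule measure_eqI_countable[where A = UNIV])
      fix n :: nat
      have "X -` {n} \<inter> space M = {\<omega> \<in> space M. X \<omega> = n}" by auto
      then show "emeasure (distr M (count_space UNIV) X) {n}
          = emeasure (density (count_space UNIV) (\<lambda>n. ennreal (p n))) {n}"
        using X p by (simp add: emeasure_distr emeasure_density emeasure_eq_measure)
    qed auto
  qed (use X in auto)
  have int: "integrable (count_space UNIV) (\<lambda>n. p n * g n)"
    using sums nonneg p_nonneg by (simp add: integrable_count_space_nat_iff sums_iff)
  then show "integrable M (\<lambda>\<omega>. g (X \<omega>))"
    using distributed_integrable[OF distr, of g] p_nonneg by simp
  show "expectation (\<lambda>\<omega>. g (X \<omega>)) = S"
    using distributed_integral[OF distr, of g] p_nonneg integral_count_space_nat[OF int] sums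
    by (simp add: sums_iff)
qed

section \<open>The binomial series of the degenerate exponential\<close>

text \<open>
  Taking \<open>lam\<close> out of each factor turns the series of the degenerate exponential into the
  binomial series of \<open>1 + lam * x\<close> with exponent \<open>1 / lam\<close>.
\<close>

lemma lambda_falling_eq_gbinomial:
  assumes "lam \<noteq> 0"
  shows "lambda_falling lam 1 n * x ^ n / fact n = ((1 / lam) gchoose n) * (lam * x) ^ n"
proof -
  have "lambda_falling lam 1 n = (\<Prod>k<n. lam * (1 / lam - real k))"
    unfolding lambda_falling_def using assms by (intro prod.cong) (auto simp: field_simps)
  also have "\<dots> = lam ^ n * (\<Prod>k<n. 1 / lam - real k)"
    by (simp add: prod.distrib)
  finally show ?thesis
    by (simp add: gbinomial_prod_rev power_mult_distrib atLeast0LessThan)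
qed

text \<open>
  The factors \<open>1 - k * lam\<close> decrease in \<open>k\<close> and eventually become negative.  If none of them
  vanished, the product ending with the first negative factor would be negative; hence
  \<open>k * lam = 1\<close> for some \<open>k\<close>.
\<close>

lemma reciprocal_nat_of_lambda_falling_nonneg:
  assumes lam: "lam > 0" and nonneg: "\<And>n. lambda_falling lam 1 n \<ge> 0"
  obtains m :: nat where "1 / lam = real m"
proof -
  define m where "m = nat \<lfloor>1 / lam\<rfloor>"
  have m: "real m \<le> 1 / lam" "1 / lam < real (Suc m)"
    using lam unfolding m_def by (simp_all, linarith+)
  have "real m = 1 / lam"
  proof (rule ccontr)
    assume "real m \<noteq> 1 / lam"
    with m have less: "real m < 1 / lam" by simp
    have "1 - real k * lam > 0" if "k < Suc m" for k
    proof -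
      have "real k \<le> real m" using that by simp
      with less have "real k < 1 / lam" by linarith
      then show ?thesis using lam by (simp add: field_simps)
    qed
    then have "lambda_falling lam 1 (Suc m) > 0"
      unfolding lambda_falling_def by (intro prod_pos) auto
    moreover have "1 - real (Suc m) * lam < 0"
      using m(2) lam by (simp add: field_simps)
    ultimately have "lambda_falling lam 1 (Suc m) * (1 - real (Suc m) * lam) < 0"
      by (rule mult_pos_neg)
    then have "lambda_falling lam 1 (Suc (Suc m)) < 0"
      by (simp add: lambda_falling_def)
    then show False
      using nonneg[of "Suc (Suc m)"] by simp
  qed
  then show ?thesis using that[of m] by simp
qed

lemma degenerate_exp_gt_1:
  assumes "x > 0" "1 + lam * x > 0"
  shows "degenerate_exp lam 1 x > 1"
proof (cases "lam = 0")
  case False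
  have "ln (1 + lam * x) / lam > 0"
  proof (cases "lam > 0")
    case True
    then show ?thesis using assms by simp
  next
    case neg: False
    with False have "lam * x < 0" using assms by (simp add: mult_neg_pos)
    then show ?thesis using assms neg False by (intro divide_neg_neg) auto
  qed
  then show ?thesis
    using False assms by (simp add: degenerate_exp_def powr_def)
qed (use assms in \<open>simp add: degenerate_exp_def\<close>)

text \<open>
  For \<open>lam < 0\<close> the binomial series converges for \<open>\<bar>lam * x\<bar> < 1\<close>, and \<open>1 + lam * \<alpha> > 0\<close> says that
  \<open>\<alpha>\<close> lies strictly below \<open>- 1 / lam\<close>.  For \<open>lam > 0\<close> the value of \<open>lam * \<alpha>\<close> may exceed \<open>1\<close>, outside
  the disc of convergence of a general binomial series; nonnegativity of the coefficients saves
  the situation by forcing an integer exponent.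
\<close>

lemma degenerate_exp_sums_beyond:
  assumes \<alpha>: "\<alpha> > 0" "1 + lam * \<alpha> > 0"
    and nonneg: "\<And>n. lambda_falling lam 1 n \<ge> 0"
  obtains r where "r > \<alpha>"
    "\<And>x. 0 \<le> x \<Longrightarrow> x < r \<Longrightarrow>
       (\<lambda>n. lambda_falling lam 1 n * x ^ n / fact n) sums degenerate_exp lam 1 x"
proof (cases lam "0 :: real" rule: linorder_cases)
  case less
  show ?thesis
  proof (rule that[of "- 1 / lam"])
    show "\<alpha> < - 1 / lam"
      using less \<alpha> by (simp add: field_simps)
    fix x :: real assume x: "0 \<le> x" "x < - 1 / lam"
    have "lam * x \<le> 0" "lam * x > -1"
      using less x by (simp_all add: mult_nonpos_nonneg field_simps)
    then have "(\<lambda>n. ((1 / lam) gchoose n) * (lam * x) ^ n) sums (1 + lam * x) powr (1 / lam)"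
      by (intro gen_binomial_real) auto
    then show "(\<lambda>n. lambda_falling lam 1 n * x ^ n / fact n) sums degenerate_exp lam 1 x"
      using less by (simp add: lambda_falling_eq_gbinomial degenerate_exp_def)
  qed
next
  case equal
  show ?thesis
  proof (rule that[of "\<alpha> + 1"])
    fix x :: real
    show "(\<lambda>n. lambda_falling lam 1 n * x ^ n / fact n) sums degenerate_exp lam 1 x"
      using exp_real_sums[of x] equal by (simp add: lambda_falling_def degenerate_exp_def)
  qed simp
next
  case greater
  then obtain m :: nat where m: "1 / lam = real m"
    using reciprocal_nat_of_lambda_falling_nonneg nonneg by blast
  show ?thesis
  proof (rule that[of "\<alpha> + 1"])
    fix x :: real assume x: "0 \<le> x"
    have pos: "1 + lam * x > 0"
      using x greater by (simp add: add_pos_nonneg)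
    have "(\<lambda>n. real (m choose n) * (lam * x) ^ n) sums (\<Sum>n\<le>m. real (m choose n) * (lam * x) ^ n)"
      by (rule sums_finite) (auto simp: binomial_eq_0)
    also have "(\<Sum>n\<le>m. real (m choose n) * (lam * x) ^ n) = (1 + lam * x) powr (1 / lam)"
      using binomial_ring[of "lam * x" 1 m] pos m by (simp add: powr_realpow add.commute)
    finally show "(\<lambda>n. lambda_falling lam 1 n * x ^ n / fact n) sums degenerate_exp lam 1 x"
      using greater m by (simp add: lambda_falling_eq_gbinomial degenerate_exp_def binomial_gbinomial)
  qed simp
qed

section \<open>Degenerate Bell polynomials as Taylor coefficients\<close>

text \<open>
  After division by \<open>x ^ subdegree H\<close>, the value at \<open>0\<close> is the leading coefficient of \<open>H\<close> but all
  values nearby are \<open>0\<close>; a function with a power series expansion is continuous at \<open>0\<close>.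
\<close>

lemma has_fps_expansion_zero_imp_eq_zero:
  fixes H :: "'a :: {banach, real_normed_field} fps"
  assumes "(\<lambda>_. 0) has_fps_expansion H"
  shows "H = 0"
proof (rule ccontr)
  assume "H \<noteq> 0"
  define c where "c = fps_nth H (subdegree H)"
  have c: "c \<noteq> 0"
    using \<open>H \<noteq> 0\<close> by (simp add: c_def)
  have "(\<lambda>x. if x = 0 then c else 0 / x ^ subdegree H) has_fps_expansion fps_shift (subdegree H) H"
    using assms by (intro has_fps_expansion_shift) (simp_all add: c_def)
  then have "(\<lambda>x::'a. if x = 0 then c else 0) has_fps_expansion fps_shift (subdegree H) H"
    by (simp cong: if_cong)
  from has_fps_expansion_imp_continuous[OF this, of UNIV]
  have "((\<lambda>x::'a. if x = 0 then c else 0) \<longlongrightarrow> c) (at 0)"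
    by (simp add: continuous_within)
  moreover have "((\<lambda>x::'a. if x = 0 then c else 0) \<longlongrightarrow> 0) (at 0)"
    by (rule tendsto_eventually) (simp add: eventually_at_filter)
  ultimately have "c = 0"
    using tendsto_unique[OF at_neq_bot] by blast
  with c show False by simp
qed

lemma has_fps_expansion_unique:
  fixes F G :: "'a :: {banach, real_normed_field} fps"
  assumes "f has_fps_expansion F" "f has_fps_expansion G"
  shows "F = G"
  using has_fps_expansion_zero_imp_eq_zero[of "F - G"] has_fps_expansion_diff[OF assms] by simp

text \<open>
  By uniqueness of power series coefficients, any expansion of the generating function identifies
  the degenerate Bell values, which are given by a definite description.
\<close>

lemma degenerate_Bell_eqI:
  assumes "(\<lambda>t. degenerate_exp_inv lam x * degenerate_exp lam 1 (x * exp t))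
             has_fps_expansion Abs_fps (\<lambda>n. b n / fact n)"
  shows "degenerate_Bell lam n x = b n"
proof -
  have "b' = b" if "(\<lambda>t. degenerate_exp_inv lam x * degenerate_exp lam 1 (x * exp t))
             has_fps_expansion Abs_fps (\<lambda>n. b' n / fact n)" for b'
    using has_fps_expansion_unique[OF that assms] by (auto simp: fps_eq_iff)
  with assms have "(THE b. (\<lambda>t. degenerate_exp_inv lam x * degenerate_exp lam 1 (x * exp t))
             has_fps_expansion Abs_fps (\<lambda>n. b n / fact n)) = b"
    by (rule the_equality)
  then show ?thesis
    unfolding degenerate_Bell_def by simp
qed

section \<open>Moments of the zero-truncated law\<close>

lemma (in prob_space) degenerate_ztp_exponential_moment:
  fixes X :: "'a \<Rightarrow> nat"
  assumes X: "degenerate_ztp_rv M lam \<alpha> X"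
    and sums: "(\<lambda>n. lambda_falling lam 1 n * (\<alpha> * exp t) ^ n / fact n)
                 sums degenerate_exp lam 1 (\<alpha> * exp t)"
  shows "integrable M (\<lambda>\<omega>. exp (t * real (X \<omega>)))"
    and "expectation (\<lambda>\<omega>. exp (t * real (X \<omega>))) =
           (degenerate_exp lam 1 (\<alpha> * exp t) - 1) / (degenerate_exp lam 1 \<alpha> - 1)"
proof -
  define e where "e = degenerate_exp lam 1 \<alpha>"
  \<comment> \<open>At \<open>0\<close> the mass formula would give a positive value, whereas \<open>X\<close> never takes the value \<open>0\<close>.\<close>
  define p where "p n = (if n = 0 then 0 else degenerate_ztp_mass lam \<alpha> n)" for n
  have X_ge: "X \<omega> \<ge> 1" if "\<omega> \<in> space M" for \<omega>
    using X that by (simp add: degenerate_ztp_rv_def)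
  have "{\<omega> \<in> space M. X \<omega> = 0} = {}"
    using X_ge by force
  then have "prob {\<omega> \<in> space M. X \<omega> = 0} = 0"
    by (simp only: measure_empty)
  then have p: "prob {\<omega> \<in> space M. X \<omega> = n} = p n" for n
    using X by (cases "n = 0") (simp_all add: p_def degenerate_ztp_rv_def)
  have "(\<lambda>n. (lambda_falling lam 1 n * (\<alpha> * exp t) ^ n / fact n - (if n = 0 then 1 else 0)) / (e - 1))
          sums ((degenerate_exp lam 1 (\<alpha> * exp t) - 1) / (e - 1))"
    using sums sums_If_finite_set[of "{0}" "\<lambda>_. 1 :: real"] by (intro sums_divide sums_diff) auto
  also have "(\<lambda>n. (lambda_falling lam 1 n * (\<alpha> * exp t) ^ n / fact n - (if n = 0 then 1 else 0)) / (e - 1))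
      = (\<lambda>n. p n * exp (t * real n))"
  proof
    fix n
    show "(lambda_falling lam 1 n * (\<alpha> * exp t) ^ n / fact n - (if n = 0 then 1 else 0)) / (e - 1)
      = p n * exp (t * real n)"
    proof (cases "n = 0")
      case False
      have "(\<alpha> * exp t) ^ n = \<alpha> ^ n * exp (t * real n)"
        by (simp only: power_mult_distrib exp_of_nat2_mult)
      with False show ?thesis
        by (simp add: p_def degenerate_ztp_mass_def e_def mult_ac)
    qed (simp add: p_def lambda_falling_def)
  qed
  finally have S: "(\<lambda>n. p n * exp (t * real n)) sums ((degenerate_exp lam 1 (\<alpha> * exp t) - 1) / (e - 1))" .
  have "X \<in> measurable M (count_space UNIV)"
    using X by (simp add: degenerate_ztp_rv_def)
  from expectation_of_nat_valued[OF this p S]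
  show "integrable M (\<lambda>\<omega>. exp (t * real (X \<omega>)))"
    and "expectation (\<lambda>\<omega>. exp (t * real (X \<omega>))) =
           (degenerate_exp lam 1 (\<alpha> * exp t) - 1) / (degenerate_exp lam 1 \<alpha> - 1)"
    by (simp_all add: e_def)
qed

text \<open>
  The generating function of the degenerate Bell polynomials is an affine image of the moment
  generating function:
  \<open>e(\<alpha> exp t) / e(\<alpha>) = (1 - 1 / e(\<alpha>)) * (e(\<alpha> exp t) - 1) / (e(\<alpha>) - 1) + 1 / e(\<alpha>)\<close>.
  The added constant affects only the coefficient of index \<open>0\<close>, so that the formula for the moments
  holds from \<open>n = 1\<close> on.
\<close>

lemma (in prob_space) degenerate_ztp_moments:
  fixes X :: "'a \<Rightarrow> nat"
  assumes X: "degenerate_ztp_rv M lam \<alpha> X" and n: "n \<ge> 1"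
  shows "integrable M (\<lambda>\<omega>. real (X \<omega>) ^ n)"
    and "expectation (\<lambda>\<omega>. real (X \<omega>) ^ n) =
           1 / (1 - degenerate_exp_inv lam \<alpha>) * degenerate_Bell lam n \<alpha>"
proof -
  define e where "e = degenerate_exp lam 1 \<alpha>"
  define \<mu> where "\<mu> k = expectation (\<lambda>\<omega>. real (X \<omega>) ^ k)" for k
  have \<alpha>: "\<alpha> > 0" "1 + lam * \<alpha> > 0"
    and mass: "\<And>n. n \<ge> 1 \<Longrightarrow> degenerate_ztp_mass lam \<alpha> n \<ge> 0"
    using X by (auto simp: degenerate_ztp_rv_def degenerate_ztp_params_def)
  have e: "e > 1"
    unfolding e_def using \<alpha> by (rule degenerate_exp_gt_1)
  have falling: "lambda_falling lam 1 n \<ge> 0" for n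
  proof (cases "n = 0")
    case False
    have "1 / (e - 1) * (\<alpha> ^ n / fact n) > 0"
      using e \<alpha> by simp
    moreover have "1 / (e - 1) * (\<alpha> ^ n / fact n) * lambda_falling lam 1 n \<ge> 0"
      using mass[of n] False by (simp add: degenerate_ztp_mass_def e_def)
    ultimately show ?thesis
      by (metis zero_le_mult_iff less_le_not_le)
  qed (simp add: lambda_falling_def)
  obtain r where r: "r > \<alpha>"
    and series: "\<And>x. 0 \<le> x \<Longrightarrow> x < r \<Longrightarrow>
       (\<lambda>n. lambda_falling lam 1 n * x ^ n / fact n) sums degenerate_exp lam 1 x"
    using degenerate_exp_sums_beyond[OF \<alpha> falling] by blast
  \<comment> \<open>Half of the exponent for which \<open>\<alpha> * exp t\<close> reaches \<open>r\<close>: the series then converges at \<open>t = s\<close> too.\<close>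
  define s where "s = ln (r / \<alpha>) / 2"
  have s: "s > 0"
    using r \<alpha> by (simp add: s_def)
  have mgf: "integrable M (\<lambda>\<omega>. exp (t * real (X \<omega>)))"
      "expectation (\<lambda>\<omega>. exp (t * real (X \<omega>))) = (degenerate_exp lam 1 (\<alpha> * exp t) - 1) / (e - 1)"
    if "t \<le> s" for t
  proof -
    have "t < ln (r / \<alpha>)" using that s by (simp add: s_def)
    then have "exp t < exp (ln (r / \<alpha>))" by simp
    then have "exp t < r / \<alpha>"
      using r \<alpha> by simp
    then have "\<alpha> * exp t < r" using \<alpha> by (simp add: field_simps)
    then have "(\<lambda>n. lambda_falling lam 1 n * (\<alpha> * exp t) ^ n / fact n) sums degenerate_exp lam 1 (\<alpha> * exp t)"
      using \<alpha> by (intro series) simp_all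
    from degenerate_ztp_exponential_moment[OF X this]
    show "integrable M (\<lambda>\<omega>. exp (t * real (X \<omega>)))"
      "expectation (\<lambda>\<omega>. exp (t * real (X \<omega>))) = (degenerate_exp lam 1 (\<alpha> * exp t) - 1) / (e - 1)"
      by (simp_all add: e_def)
  qed
  have [measurable]: "X \<in> measurable M (count_space UNIV)"
    using X by (simp add: degenerate_ztp_rv_def)
  have meas: "(\<lambda>\<omega>. real (X \<omega>)) \<in> borel_measurable M"
    by measurable
  show "integrable M (\<lambda>\<omega>. real (X \<omega>) ^ n)"
    using meas _ s mgf(1)[OF order_refl] by (rule integrable_power_of_exponential_moment) simp

  define b where "b k = (1 - 1 / e) * \<mu> k + (if k = 0 then 1 / e else 0)" for k
  have expansion: "(\<lambda>k. b k / fact k * t ^ k) sums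
      (degenerate_exp_inv lam \<alpha> * degenerate_exp lam 1 (\<alpha> * exp t))"
    if t: "\<bar>t\<bar> < s" for t
  proof -
    have "(\<lambda>k. \<mu> k / fact k * t ^ k) sums expectation (\<lambda>\<omega>. exp (t * real (X \<omega>)))"
      unfolding \<mu>_def
      using t by (intro moment_generating_function_sums[OF meas _ s mgf(1)[OF order_refl]]) simp_all
    also have "expectation (\<lambda>\<omega>. exp (t * real (X \<omega>))) = (degenerate_exp lam 1 (\<alpha> * exp t) - 1) / (e - 1)"
      using t by (intro mgf) simp
    finally have "(\<lambda>k. (1 - 1 / e) * (\<mu> k / fact k * t ^ k) + (if k = 0 then 1 / e else 0)) sums
        ((1 - 1 / e) * ((degenerate_exp lam 1 (\<alpha> * exp t) - 1) / (e - 1)) + 1 / e)"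
      using sums_If_finite_set[of "{0}" "\<lambda>_. 1 / e"] by (intro sums_add sums_mult) auto
    also have "(\<lambda>k. (1 - 1 / e) * (\<mu> k / fact k * t ^ k) + (if k = 0 then 1 / e else 0))
        = (\<lambda>k. b k / fact k * t ^ k)"
      by (auto simp: b_def)
    also have "(1 - 1 / e) * ((degenerate_exp lam 1 (\<alpha> * exp t) - 1) / (e - 1)) + 1 / e
        = degenerate_exp_inv lam \<alpha> * degenerate_exp lam 1 (\<alpha> * exp t)"
    proof -
      have "(1 - 1 / e) / (e - 1) = 1 / e"
        using e by (simp add: field_simps)
      then have "(1 - 1 / e) * ((y - 1) / (e - 1)) + 1 / e = 1 / e * y" for y
        by (metis add.commute diff_add_cancel distrib_left mult.right_neutral times_divide_eq_left times_divide_eq_right)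
      then show ?thesis by (simp add: degenerate_exp_inv_def e_def)
    qed
    finally show ?thesis .
  qed
  have "eventually (\<lambda>t. \<bar>t\<bar> < s) (nhds (0 :: real))"
    using s eventually_nhds_metric[of "\<lambda>t. \<bar>t\<bar> < s" "0 :: real"] by (auto simp: dist_real_def)
  then have "(\<lambda>t. degenerate_exp_inv lam \<alpha> * degenerate_exp lam 1 (\<alpha> * exp t))
      has_fps_expansion Abs_fps (\<lambda>k. b k / fact k)"
    by (intro has_fps_expansionI, unfold fps_nth_Abs_fps) (erule eventually_mono, rule expansion)
  then have "degenerate_Bell lam n \<alpha> = b n"
    by (rule degenerate_Bell_eqI)
  also have "\<dots> = (1 - 1 / e) * \<mu> n"
    using n by (simp add: b_def)
  finally show "expectation (\<lambda>\<omega>. real (X \<omega>) ^ n) =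
      1 / (1 - degenerate_exp_inv lam \<alpha>) * degenerate_Bell lam n \<alpha>"
    using e by (simp add: degenerate_exp_inv_def e_def \<mu>_def)
qed

theorem theorem2p3:
  fixes M :: "'a measure" and lam \<alpha> :: real and X :: "'a \<Rightarrow> nat"
  assumes "prob_space M"
    and "\<alpha> > 0"
    and "degenerate_ztp_rv M lam \<alpha> X"
  shows "(\<forall>n\<ge>1. integrable M (\<lambda>\<omega>. real (X \<omega>) ^ n) \<and>
            prob_space.expectation M (\<lambda>\<omega>. real (X \<omega>) ^ n) =
              1 / (1 - degenerate_exp_inv lam \<alpha>) * degenerate_Bell lam n \<alpha>) \<and>
         prob_space.expectation M (\<lambda>\<omega>. 1 :: real) =
           prob_space.expectation M (\<lambda>\<omega>. real (X \<omega>) ^ 0) \<and>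
         prob_space.expectation M (\<lambda>\<omega>. real (X \<omega>) ^ 0) = 1"
proof -
  interpret prob_space M by fact
  show ?thesis
    using degenerate_ztp_moments[OF assms(3)] by (simp add: prob_space)
qed

end
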